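(* Let $T$ be a tree with $n=|V(T)|$ vertices and let $k$ be an integer with $2\leq k\leq n-1$. Then $$ Sz_{k}(T)=\sum_{e=uv\in E(T)} \left({n_u(e)-1 \choose k-1}+1\right)\left({n_v(e)-1\choose k-1}+ 1\right). $$
   Context: For a connected graph $G$ and $S\subseteq V(G)$, the Steiner distance $d_G(S)$ is the minimum number of edges of a connected subgraph (equivalently, a subtree) of $G$ whose vertex set contains $S$. For an edge $e=uv$ of $G$, $n_u(e)$ denotes the number of vertices $w$ of $G$ with $d_G(w,u)<d_G(w,v)$ (for a tree, this is the number of vertices of the component of $T-e$ containing $u$), and $n_v(e)$ is defined symmetrically. For a positive integer $k$, define $N_u(e;k)=\{S'\subseteq V(G)\setminus\{u,v\} : |S'|=k-1,\ d_G(S'\cup\{u\})<d_G(S'\cup\{v\})\}$, $N_v(e;k)=\{S'\subseteq V(G)\setminus\{u,v\} : |S'|=k-1,\ d_G(S'\cup\{v\})<d_G(S'\cup\{u\})\}$, and $n_u(e;k)=|N_u(e;k)|$, $n_v(e;k)=|N_v(e;k)|$. The $k$th Steiner Szeged index is $Sz_k(G)=\sum_{e=uv\in E(G)}(n_u(e;k)+1)(n_v(e;k)+1)$. *)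

theory Defs
  imports Main
begin

text \<open>
  A finite simple undirected graph is given by its vertex set \<open>V\<close> and its edge set \<open>E\<close>,
  an edge being the two-element set of its end vertices.
  (\<open>tree\<close> of the AFP entry \<open>Graph_Theory\<close> does not fit here: undirected graphs are
  symmetric digraphs there, in which the two arcs of an edge already form a cycle.)
\<close>

definition simple_graph :: "'a set \<Rightarrow> 'a set set \<Rightarrow> bool" where
  "simple_graph V E \<longleftrightarrow>
     finite V \<and> (\<forall>e\<in>E. \<exists>u\<in>V. \<exists>v\<in>V. u \<noteq> v \<and> e = {u, v})"

definition walk :: "'a set \<Rightarrow> 'a set set \<Rightarrow> 'a list \<Rightarrow> bool" where
  "walk V E p \<longleftrightarrow>
     p \<noteq> [] \<and> set p \<subseteq> V \<and> (\<forall>i. Suc i < length p \<longrightarrow> {p ! i, p ! Suc i} \<in> E)"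

definition connected_graph :: "'a set \<Rightarrow> 'a set set \<Rightarrow> bool" where
  "connected_graph V E \<longleftrightarrow>
     simple_graph V E \<and> V \<noteq> {} \<and>
     (\<forall>u\<in>V. \<forall>v\<in>V. \<exists>p. walk V E p \<and> hd p = u \<and> last p = v)"

definition graph_cycle :: "'a set \<Rightarrow> 'a set set \<Rightarrow> 'a list \<Rightarrow> bool" where
  "graph_cycle V E c \<longleftrightarrow>
     walk V E c \<and> distinct c \<and> 3 \<le> length c \<and> {last c, hd c} \<in> E"

definition tree_graph :: "'a set \<Rightarrow> 'a set set \<Rightarrow> bool" where
  "tree_graph V E \<longleftrightarrow> connected_graph V E \<and> (\<nexists>c. graph_cycle V E c)"

definition is_subgraph :: "'a set \<Rightarrow> 'a set set \<Rightarrow> 'a set \<Rightarrow> 'a set set \<Rightarrow> bool" where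
  "is_subgraph V' E' V E \<longleftrightarrow> simple_graph V' E' \<and> V' \<subseteq> V \<and> E' \<subseteq> E"

text \<open>
  Both distances are meant for connected graphs (and vertices, resp. sets of vertices, of the
  graph); there the sets of numbers whose least element is taken are nonempty.
\<close>

definition graph_dist :: "'a set \<Rightarrow> 'a set set \<Rightarrow> 'a \<Rightarrow> 'a \<Rightarrow> nat" where
  "graph_dist V E u v =
     (LEAST l. \<exists>p. walk V E p \<and> hd p = u \<and> last p = v \<and> length p = Suc l)"

definition steiner_dist :: "'a set \<Rightarrow> 'a set set \<Rightarrow> 'a set \<Rightarrow> nat" where
  "steiner_dist V E S =
     (LEAST m. \<exists>V' E'. is_subgraph V' E' V E \<and> connected_graph V' E' \<and> S \<subseteq> V' \<and> card E' = m)"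

text \<open>
  For an edge \<open>e = {u, v}\<close>, the values \<open>n\<^sub>u(e)\<close> and \<open>n\<^sub>v(e)\<close> are \<open>near_count V E u v\<close> and
  \<open>near_count V E v u\<close>; the first vertex argument is the one in the subscript, and the
  unordered edge is recovered as the set of both arguments. The same convention applies to
  \<open>N\<^sub>u(e;k)\<close> and \<open>n\<^sub>u(e;k)\<close>.
\<close>

definition near_count :: "'a set \<Rightarrow> 'a set set \<Rightarrow> 'a \<Rightarrow> 'a \<Rightarrow> nat" where
  "near_count V E u v = card {w \<in> V. graph_dist V E w u < graph_dist V E w v}"

definition steiner_near_sets ::
    "'a set \<Rightarrow> 'a set set \<Rightarrow> nat \<Rightarrow> 'a \<Rightarrow> 'a \<Rightarrow> 'a set set" where
  "steiner_near_sets V E k u v =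
     {S. S \<subseteq> V - {u, v} \<and> card S = k - 1 \<and>
         steiner_dist V E (S \<union> {u}) < steiner_dist V E (S \<union> {v})}"

definition steiner_near_count :: "'a set \<Rightarrow> 'a set set \<Rightarrow> nat \<Rightarrow> 'a \<Rightarrow> 'a \<Rightarrow> nat" where
  "steiner_near_count V E k u v = card (steiner_near_sets V E k u v)"

text \<open>
  \<open>edge_sum E f\<close> is the sum of \<open>f u v\<close> over the unordered edges \<open>e = uv\<close> in \<open>E\<close>, each counted
  once. It is only meant for symmetric \<open>f\<close>, for which the summand does not depend on the order
  in which the ends of \<open>e\<close> are named.
\<close>

definition edge_val :: "('a \<Rightarrow> 'a \<Rightarrow> 'b) \<Rightarrow> 'a set \<Rightarrow> 'b" where
  "edge_val f e = (THE x. \<exists>u v. e = {u, v} \<and> x = f u v)"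

definition edge_sum :: "'a set set \<Rightarrow> ('a \<Rightarrow> 'a \<Rightarrow> 'b::comm_monoid_add) \<Rightarrow> 'b" where
  "edge_sum E f = (\<Sum>e\<in>E. edge_val f e)"

lemma edge_val_eq:
  assumes "\<And>x y. f x y = f y x"
  shows "edge_val f {u, v} = f u v"
  unfolding edge_val_def
proof (rule the_equality)
  show "\<exists>u' v'. {u, v} = {u', v'} \<and> f u v = f u' v'"
    by blast
  show "x = f u v" if "\<exists>u' v'. {u, v} = {u', v'} \<and> x = f u' v'" for x
    using that assms by (auto simp: doubleton_eq_iff)
qed

definition steiner_szeged :: "'a set \<Rightarrow> 'a set set \<Rightarrow> nat \<Rightarrow> nat" where
  "steiner_szeged V E k =
     edge_sum E (\<lambda>u v. (steiner_near_count V E k u v + 1) * (steiner_near_count V E k v u + 1))"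

end

theory Submission
  imports Defs
begin

text \<open>
  Deleting an edge \<open>uv\<close> of a tree separates \<open>V\<close> into a side \<open>A\<close> containing \<open>u\<close> and its complement
  containing \<open>v\<close>, and \<open>uv\<close> is the only edge between the two; everything else follows from this cut.
  A walk that changes sides runs through \<open>u\<close> and \<open>v\<close>, so \<open>A\<close> is the set of vertices nearer to \<open>u\<close>.
  If \<open>S\<close> meets both sides, every connected subgraph containing \<open>S\<close> contains \<open>u\<close> and \<open>v\<close>, and the two
  Steiner distances agree. If \<open>S \<noteq> {}\<close> lies in \<open>A\<close>, cutting an optimal subgraph for \<open>S \<union> {v}\<close> down
  to \<open>A\<close> loses the edge \<open>uv\<close> and still connects \<open>S \<union> {u}\<close>. Hence the sets counted by \<open>n\<^sub>u(e;k)\<close>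
  are the \<open>(k - 1)\<close>-subsets of \<open>A - {u}\<close>.
\<close>

section \<open>Walks and connectedness\<close>

lemma walk_take:
  assumes "walk V E p" "Suc i \<le> length p"
  shows "walk V E (take (Suc i) p)" "hd (take (Suc i) p) = hd p" "last (take (Suc i) p) = p ! i"
proof -
  show "walk V E (take (Suc i) p)" using assms by (auto simp: walk_def dest: in_set_takeD)
  show "hd (take (Suc i) p) = hd p" by (cases p) auto
  show "last (take (Suc i) p) = p ! i" using assms by (simp add: take_Suc_conv_app_nth)
qed

lemma walk_snoc:
  assumes "walk V E p" "z \<in> V" "{last p, z} \<in> E"
  shows "walk V E (p @ [z])"
  unfolding walk_def
proof (intro conjI allI impI)
  fix i assume "Suc i < length (p @ [z])"
  then consider "Suc i < length p" | "Suc i = length p" by force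
  then show "{(p @ [z]) ! i, (p @ [z]) ! Suc i} \<in> E"
  proof cases
    case 1
    with assms show ?thesis by (auto simp: walk_def nth_append)
  next
    case 2
    then have "p ! i = last p" by (cases p rule: rev_cases) auto
    with 2 assms show ?thesis by (auto simp: nth_append)
  qed
qed (use assms in \<open>auto simp: walk_def\<close>)

text \<open>The least index whose vertex lies outside \<open>A\<close> is positive, and its
  predecessor is the wanted \<open>i\<close>.\<close>

lemma walk_crossing:
  assumes "walk V E p" "hd p \<in> A" "last p \<notin> A"
  obtains i where "Suc i < length p" "p ! i \<in> A" "p ! Suc i \<notin> A"
proof -
  have "p \<noteq> []" using assms by (auto simp: walk_def)
  then have "\<not> p ! 0 \<notin> A" "p ! (length p - 1) \<notin> A"
    using assms by (auto simp: hd_conv_nth last_conv_nth)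
  from ex_least_nat_less[of "\<lambda>i. p ! i \<notin> A", OF this(2,1)]
  obtain i where "i < length p - 1" "\<forall>j\<le>i. \<not> p ! j \<notin> A" "p ! Suc i \<notin> A"
    by blast
  then show thesis by (intro that[of i]) auto
qed

text \<open>Turns connectedness into reachability, so that later arguments go by
  \<open>rtrancl_induct\<close> instead of list indices.\<close>

definition adjacency :: "'a set \<Rightarrow> 'a set set \<Rightarrow> 'a rel" where
  "adjacency V E = {(x, y). x \<in> V \<and> y \<in> V \<and> {x, y} \<in> E}"

lemma walk_imp_adjacency_rtrancl:
  assumes "walk V E p"
  shows "(hd p, last p) \<in> (adjacency V E)\<^sup>*"
proof -
  have "i < length p \<longrightarrow> (p ! 0, p ! i) \<in> (adjacency V E)\<^sup>*" for i
  proof (induction i)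
    case (Suc i)
    show ?case
    proof
      assume i: "Suc i < length p"
      then have "p ! i \<in> set p" "p ! Suc i \<in> set p" by auto
      with i assms have "(p ! i, p ! Suc i) \<in> adjacency V E"
        by (auto simp: walk_def adjacency_def)
      with Suc i show "(p ! 0, p ! Suc i) \<in> (adjacency V E)\<^sup>*"
        by (auto intro: rtrancl_into_rtrancl)
    qed
  qed simp
  from this[of "length p - 1"] assms show ?thesis
    by (auto simp: walk_def hd_conv_nth last_conv_nth)
qed

text \<open>A step back to a visited vertex truncates the walk there instead of extending it.
  Distinctness is what later turns a closed walk into a \<open>graph_cycle\<close>.\<close>

lemma adjacency_rtrancl_imp_distinct_walk:
  assumes "(x, y) \<in> (adjacency V E)\<^sup>*" "x \<in> V"
  shows "\<exists>p. walk V E p \<and> distinct p \<and> hd p = x \<and> last p = y"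
  using assms(1)
proof (induction rule: rtrancl_induct)
  case base
  show ?case using assms(2) by (intro exI[of _ "[x]"]) (auto simp: walk_def)
next
  case (step y z)
  then obtain p where p: "walk V E p" "distinct p" "hd p = x" "last p = y" by auto
  show ?case
  proof (cases "z \<in> set p")
    case True
    then obtain i where "i < length p" "p ! i = z" by (auto simp: in_set_conv_nth)
    with p show ?thesis
      by (intro exI[of _ "take (Suc i) p"]) (simp add: walk_take)
  next
    case False
    have "walk V E (p @ [z])"
      using step p by (intro walk_snoc) (auto simp: adjacency_def)
    moreover have "p \<noteq> []" using p by (auto simp: walk_def)
    ultimately show ?thesis using p False
      by (intro exI[of _ "p @ [z]"]) auto
  qed
qed

lemma connected_graph_iff:
  "connected_graph V E \<longleftrightarrow>
     simple_graph V E \<and> V \<noteq> {} \<and> (\<forall>x\<in>V. \<forall>y\<in>V. (x, y) \<in> (adjacency V E)\<^sup>*)"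
proof -
  have "(\<exists>p. walk V E p \<and> hd p = x \<and> last p = y) \<longleftrightarrow> (x, y) \<in> (adjacency V E)\<^sup>*"
    if "x \<in> V" for x y
    using that walk_imp_adjacency_rtrancl adjacency_rtrancl_imp_distinct_walk by metis
  then show ?thesis by (simp add: connected_graph_def)
qed

lemma simple_graph_finite_edges:
  assumes "simple_graph V E"
  shows "finite E"
proof (rule finite_subset)
  show "E \<subseteq> Pow V" using assms by (fastforce simp: simple_graph_def)
qed (use assms in \<open>simp add: simple_graph_def\<close>)

section \<open>Attained minima of both distances\<close>

lemma graph_dist_le:
  assumes "walk V E p" "hd p = x" "last p = y" "length p = Suc l"
  shows "graph_dist V E x y \<le> l"
  unfolding graph_dist_def using assms by (blast intro: Least_le)

lemma graph_dist_walk: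
  assumes "connected_graph V E" "x \<in> V" "y \<in> V"
  obtains p where "walk V E p" "hd p = x" "last p = y" "length p = Suc (graph_dist V E x y)"
proof -
  obtain p where p: "walk V E p" "hd p = x" "last p = y"
    using assms by (auto simp: connected_graph_def)
  then obtain l where "length p = Suc l" by (cases p) (auto simp: walk_def)
  with p have "\<exists>l p. walk V E p \<and> hd p = x \<and> last p = y \<and> length p = Suc l" by blast
  from LeastI_ex[OF this] show thesis
    using that by (auto simp: graph_dist_def)
qed

definition spans :: "'a set \<Rightarrow> 'a set set \<Rightarrow> 'a set \<Rightarrow> 'a set \<Rightarrow> 'a set set \<Rightarrow> bool" where
  "spans V E S V' E' \<longleftrightarrow> is_subgraph V' E' V E \<and> connected_graph V' E' \<and> S \<subseteq> V'"

lemma steiner_dist_le: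
  assumes "spans V E S V' E'"
  shows "steiner_dist V E S \<le> card E'"
  unfolding steiner_dist_def using assms by (auto simp: spans_def intro!: Least_le)

text \<open>The whole graph is a candidate, so the \<open>LEAST\<close> is attained.\<close>

lemma steiner_dist_witness:
  assumes "connected_graph V E" "S \<subseteq> V"
  obtains V' E' where "spans V E S V' E'" "card E' = steiner_dist V E S"
proof -
  have "is_subgraph V E V E" using assms by (auto simp: is_subgraph_def connected_graph_def)
  then have "\<exists>m V' E'. is_subgraph V' E' V E \<and> connected_graph V' E' \<and> S \<subseteq> V' \<and> card E' = m"
    using assms by blast
  from LeastI_ex[OF this] show thesis
    using that unfolding steiner_dist_def[symmetric] spans_def by blast
qed

section \<open>Bridges\<close>

text \<open>Isolates what acyclicity contributes: the distance comparisons rest on this property and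
  connectedness alone.\<close>

definition bridge_cut :: "'a set \<Rightarrow> 'a set set \<Rightarrow> 'a \<Rightarrow> 'a \<Rightarrow> 'a set \<Rightarrow> bool" where
  "bridge_cut V E u v A \<longleftrightarrow> A \<subseteq> V \<and> u \<in> A \<and> v \<in> V - A \<and>
     (\<forall>x\<in>A. \<forall>y\<in>V - A. {x, y} \<in> E \<longrightarrow> x = u \<and> y = v)"

text \<open>Transfers every result about the side of \<open>u\<close> to the side of
  \<open>v\<close>.\<close>

lemma bridge_cut_commute:
  "bridge_cut V E u v A \<Longrightarrow> bridge_cut V E v u (V - A)"
  unfolding bridge_cut_def by (metis DiffD1 DiffD2 DiffI Diff_subset insert_commute subsetD)

text \<open>Take the vertices reachable from \<open>u\<close> without the edge \<open>uv\<close>. If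
  \<open>v\<close> were among them, \<open>uv\<close> would close a cycle; any other edge leaving
  this set would enlarge it.\<close>

lemma tree_edge_bridge_cut:
  assumes tree: "tree_graph V E" and e: "{u, v} \<in> E"
  obtains A where "bridge_cut V E u v A"
proof -
  let ?R = "adjacency V (E - {{u, v}})"
  let ?A = "{w. (u, w) \<in> ?R\<^sup>*}"
  have uv: "u \<in> V" "v \<in> V" "u \<noteq> v"
    using tree e by (auto simp: tree_graph_def connected_graph_def simple_graph_def doubleton_eq_iff)
  have "?A \<subseteq> V"
  proof
    fix w assume "w \<in> ?A"
    then have "(u, w) \<in> ?R\<^sup>*" by simp
    then show "w \<in> V" using uv by (cases rule: rtrancl.cases) (auto simp: adjacency_def)
  qed
  moreover have "v \<notin> ?A"
  proof
    assume "v \<in> ?A"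
    then obtain p where p: "walk V (E - {{u, v}}) p" "distinct p" "hd p = u" "last p = v"
      using adjacency_rtrancl_imp_distinct_walk[of u v V] uv by auto
    \<comment> \<open>One vertex would give \<open>u = v\<close>; two would use the deleted
      edge.\<close>
    have "length p \<noteq> 0" "length p \<noteq> 1" "length p \<noteq> 2"
      using p uv by (auto simp: walk_def length_Suc_conv numeral_2_eq_2)
    then have "3 \<le> length p" by linarith
    with p e have "graph_cycle V E p"
      by (auto simp: graph_cycle_def walk_def insert_commute)
    with tree show False by (auto simp: tree_graph_def)
  qed
  moreover have "x = u \<and> y = v" if "x \<in> ?A" "y \<in> V - ?A" "{x, y} \<in> E" for x y
  proof (rule ccontr)
    assume neq: "\<not> (x = u \<and> y = v)"
    \<comment> \<open>\<open>u\<close> lies in \<open>?A\<close> by reflexivity, so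
      \<open>{x, y}\<close> is not the deleted edge in reverse order either.\<close>
    have "\<not> (x = v \<and> y = u)" using that by auto
    with neq that \<open>?A \<subseteq> V\<close> have "(x, y) \<in> ?R" by (auto simp: adjacency_def doubleton_eq_iff)
    with that show False by (auto dest: rtrancl_into_rtrancl)
  qed
  ultimately have "bridge_cut V E u v ?A" using uv by (auto simp: bridge_cut_def)
  then show thesis by (rule that)
qed

lemma bridge_cut_walk:
  assumes "bridge_cut V E u v A" "walk V E p" "hd p \<in> A" "last p \<notin> A"
  obtains i where "Suc i < length p" "p ! i = u" "p ! Suc i = v"
proof -
  obtain i where i: "Suc i < length p" "p ! i \<in> A" "p ! Suc i \<notin> A"
    using walk_crossing assms(2-4) by blast
  then have "p ! Suc i \<in> V" "{p ! i, p ! Suc i} \<in> E"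
    using assms(2) by (auto simp: walk_def)
  with i assms(1) have "p ! i = u" "p ! Suc i = v" by (auto simp: bridge_cut_def)
  with i show thesis using that by blast
qed

text \<open>A shortest walk from \<open>w\<close> to \<open>v\<close> visits \<open>u\<close> before
  its end, and the prefix up to \<open>u\<close> is strictly shorter.\<close>

lemma bridge_cut_dist_less:
  assumes "bridge_cut V E u v A" "connected_graph V E" "w \<in> A"
  shows "graph_dist V E w u < graph_dist V E w v"
proof -
  have "w \<in> V" "v \<in> V" "v \<notin> A" using assms by (auto simp: bridge_cut_def)
  then obtain p where p: "walk V E p" "hd p = w" "last p = v" "length p = Suc (graph_dist V E w v)"
    using graph_dist_walk assms(2) by metis
  then obtain i where i: "Suc i < length p" "p ! i = u"
    using bridge_cut_walk[OF assms(1)] \<open>w \<in> A\<close> \<open>v \<notin> A\<close> by metis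
  have "graph_dist V E w u \<le> i"
    using walk_take[OF p(1), of i] p i by (intro graph_dist_le[of _ _ "take (Suc i) p"]) auto
  with p i show ?thesis by simp
qed

text \<open>Strictness on both sides of the cut rules out ties, which gives equality and not just an
  inclusion.\<close>

lemma bridge_cut_near_set:
  assumes "bridge_cut V E u v A" "connected_graph V E"
  shows "{w \<in> V. graph_dist V E w u < graph_dist V E w v} = A"
proof -
  have "A \<subseteq> V" using assms by (simp add: bridge_cut_def)
  with bridge_cut_dist_less[OF assms] bridge_cut_dist_less[OF bridge_cut_commute[OF assms(1)] assms(2)]
  show ?thesis by (force dest: less_asym)
qed

section \<open>Steiner distances across a bridge\<close>

lemma bridge_cut_subgraph:
  assumes "bridge_cut V E u v A" "is_subgraph V' E' V E" "connected_graph V' E'"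
    and "x \<in> V' \<inter> A" "y \<in> V' - A"
  shows "u \<in> V'" "v \<in> V'" "{u, v} \<in> E'"
proof -
  obtain p where p: "walk V' E' p" "hd p = x" "last p = y"
    using assms by (auto simp: connected_graph_def)
  \<comment> \<open>Seen in the whole graph, the walk has to cross along \<open>uv\<close>, yet its
    edges belong to \<open>E'\<close>.\<close>
  have "walk V E p" using p assms(2) by (auto simp: walk_def is_subgraph_def)
  then obtain i where i: "Suc i < length p" "p ! i = u" "p ! Suc i = v"
    using bridge_cut_walk[OF assms(1)] p assms(4,5) by (metis DiffD2 IntD2)
  then have "u \<in> set p" "v \<in> set p" by auto
  with p show "u \<in> V'" "v \<in> V'" by (auto simp: walk_def)
  show "{u, v} \<in> E'" using p i by (auto simp: walk_def)
qed

text \<open>An excursion beyond \<open>A\<close> leaves from \<open>u\<close> and returns to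
  \<open>u\<close>, so cutting it out keeps the rest connected.\<close>

lemma spans_bridge_cut_side:
  assumes cut: "bridge_cut V E u v A" and spans: "spans V E S V' E'" and "S \<subseteq> A" "u \<in> V'"
  shows "spans V E (S \<union> {u}) (V' \<inter> A) {e \<in> E'. e \<subseteq> A}"
proof -
  let ?V = "V' \<inter> A" and ?E = "{e \<in> E'. e \<subseteq> A}"
  have sub: "is_subgraph V' E' V E" and conn: "connected_graph V' E'" and "S \<subseteq> V'"
    using spans by (auto simp: spans_def)
  have "u \<in> A" using cut by (simp add: bridge_cut_def)
  have "simple_graph V' E'" using conn by (simp add: connected_graph_def)
  then have simple: "simple_graph ?V ?E" unfolding simple_graph_def by fastforce
  \<comment> \<open>Collapsing the far side to \<open>u\<close> maps walks of the subgraph to walks inside \<open>A\<close>.\<close>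
  define f where "f w = (if w \<in> A then w else u)" for w
  have "(f x, f y) \<in> (adjacency ?V ?E)\<^sup>*" if "(x, y) \<in> (adjacency V' E')\<^sup>*" for x y
    using that
  proof (induction rule: rtrancl_induct)
    case (step y z)
    then have yz: "y \<in> V'" "z \<in> V'" "{y, z} \<in> E'" by (auto simp: adjacency_def)
    with sub have "y \<in> V" "z \<in> V" "{y, z} \<in> E" "{z, y} \<in> E"
      by (auto simp: is_subgraph_def insert_commute)
    with cut have "y = u" if "y \<in> A" "z \<notin> A" using that by (auto simp: bridge_cut_def)
    moreover from cut \<open>y \<in> V\<close> \<open>{z, y} \<in> E\<close> have "z = u" if "z \<in> A" "y \<notin> A"
      using that by (auto simp: bridge_cut_def)
    \<comment> \<open>An edge inside \<open>A\<close> survives; a crossing or outer edge collapses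
      to \<open>u\<close>.\<close>
    ultimately have "f y = f z \<or> (f y, f z) \<in> adjacency ?V ?E"
      using yz by (auto simp: f_def adjacency_def)
    with step.IH show ?case by (auto intro: rtrancl_into_rtrancl)
  qed simp
  then have "(x, y) \<in> (adjacency ?V ?E)\<^sup>*" if "x \<in> ?V" "y \<in> ?V" for x y
    using that conn by (fastforce simp: connected_graph_iff f_def)
  with simple \<open>u \<in> V'\<close> \<open>u \<in> A\<close> have "connected_graph ?V ?E"
    by (auto simp: connected_graph_iff)
  with simple sub \<open>S \<subseteq> V'\<close> \<open>S \<subseteq> A\<close> \<open>u \<in> V'\<close> \<open>u \<in> A\<close> show ?thesis
    by (auto simp: spans_def is_subgraph_def)
qed

text \<open>A vertex of \<open>S\<close> forces an optimal subgraph reaching \<open>v\<close> to use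
  \<open>uv\<close>, and this edge is saved. For \<open>S = {}\<close> both distances would be
  \<open>0\<close>.\<close>

lemma bridge_cut_steiner_less:
  assumes cut: "bridge_cut V E u v A" and conn: "connected_graph V E" and "S \<subseteq> A" "S \<noteq> {}"
  shows "steiner_dist V E (S \<union> {u}) < steiner_dist V E (S \<union> {v})"
proof -
  have "S \<union> {v} \<subseteq> V" "v \<notin> A" using assms by (auto simp: bridge_cut_def)
  then obtain V' E' where spans: "spans V E (S \<union> {v}) V' E'"
    and card: "card E' = steiner_dist V E (S \<union> {v})"
    using steiner_dist_witness[OF conn] by metis
  from spans have sub: "is_subgraph V' E' V E" and conn': "connected_graph V' E'"
    and "S \<subseteq> V'" "v \<in> V'" by (auto simp: spans_def)
  obtain s where "s \<in> S" using \<open>S \<noteq> {}\<close> by blast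
  then have "s \<in> V' \<inter> A" "v \<in> V' - A" using \<open>S \<subseteq> V'\<close> \<open>S \<subseteq> A\<close> \<open>v \<in> V'\<close> \<open>v \<notin> A\<close> by auto
  note uv = bridge_cut_subgraph[OF cut sub conn' this]
  have "finite E'" using conn' by (auto simp: connected_graph_def simple_graph_finite_edges)
  moreover have "{u, v} \<notin> {e \<in> E'. e \<subseteq> A}" using \<open>v \<notin> A\<close> by simp
  with uv(3) have "{e \<in> E'. e \<subseteq> A} \<subset> E'" by (metis (lifting) mem_Collect_eq psubsetI subsetI)
  ultimately have less: "card {e \<in> E'. e \<subseteq> A} < card E'" by (rule psubset_card_mono)
  \<comment> \<open>\<open>v\<close> is dropped from the required set because restriction to
    \<open>A\<close> removes it.\<close>
  have "spans V E S V' E'" using spans by (auto simp: spans_def)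
  from steiner_dist_le[OF spans_bridge_cut_side[OF cut this \<open>S \<subseteq> A\<close> uv(1)]] less card
  show ?thesis by simp
qed

text \<open>An optimal subgraph for \<open>S \<union> {u}\<close> meets both sides, hence contains
  \<open>v\<close> already.\<close>

lemma bridge_cut_steiner_le:
  assumes cut: "bridge_cut V E u v A" and conn: "connected_graph V E" and "S \<subseteq> V"
    and "S \<inter> A \<noteq> {}" "S - A \<noteq> {}"
  shows "steiner_dist V E (S \<union> {v}) \<le> steiner_dist V E (S \<union> {u})"
proof -
  have "S \<union> {u} \<subseteq> V" using assms by (auto simp: bridge_cut_def)
  then obtain V' E' where spans: "spans V E (S \<union> {u}) V' E'"
    and card: "card E' = steiner_dist V E (S \<union> {u})"
    using steiner_dist_witness[OF conn] by metis
  from spans have sub: "is_subgraph V' E' V E" and conn': "connected_graph V' E'" and "S \<subseteq> V'"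
    by (auto simp: spans_def)
  obtain x y where "x \<in> V' \<inter> A" "y \<in> V' - A" using assms(4,5) \<open>S \<subseteq> V'\<close> by blast
  from bridge_cut_subgraph(2)[OF cut sub conn' this] spans have "spans V E (S \<union> {v}) V' E'"
    by (auto simp: spans_def)
  from steiner_dist_le[OF this] card show ?thesis by simp
qed

lemma bridge_cut_steiner_near_sets:
  assumes cut: "bridge_cut V E u v A" and conn: "connected_graph V E" and "2 \<le> k"
  shows "steiner_near_sets V E k u v = {S. S \<subseteq> A - {u} \<and> card S = k - 1}"
proof -
  have A: "A \<subseteq> V" "u \<in> A" "v \<notin> A" using cut by (auto simp: bridge_cut_def)
  have "steiner_dist V E (S \<union> {u}) < steiner_dist V E (S \<union> {v}) \<longleftrightarrow> S \<subseteq> A"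
    if "S \<subseteq> V - {u, v}" "card S = k - 1" for S
  proof
    \<comment> \<open>Here \<open>2 \<le> k\<close> makes \<open>card S\<close> positive, so
      \<open>S\<close> is nonempty.\<close>
    show "steiner_dist V E (S \<union> {u}) < steiner_dist V E (S \<union> {v})" if "S \<subseteq> A"
      using bridge_cut_steiner_less[OF cut conn that] \<open>card S = k - 1\<close> \<open>2 \<le> k\<close> by fastforce
  next
    assume less: "steiner_dist V E (S \<union> {u}) < steiner_dist V E (S \<union> {v})"
    show "S \<subseteq> A"
    proof (rule ccontr)
      assume "\<not> S \<subseteq> A"
      show False
      \<comment> \<open>On the far side alone the strict inequality reverses by symmetry; on both
        sides it fails.\<close>
      proof (cases "S \<inter> A = {}")
        case True
        with that have "S \<subseteq> V - A" by auto
        from bridge_cut_steiner_less[OF bridge_cut_commute[OF cut] conn this] less \<open>\<not> S \<subseteq> A\<close>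
        show False by fastforce
      next
        case False
        with bridge_cut_steiner_le[OF cut conn, of S] that less \<open>\<not> S \<subseteq> A\<close> show False by fastforce
      qed
    qed
  qed
  with A show ?thesis unfolding steiner_near_sets_def by blast
qed

section \<open>Counting and summing over the edges\<close>

lemma tree_steiner_near_count:
  assumes tree: "tree_graph V E" and "{u, v} \<in> E" "2 \<le> k"
  shows "steiner_near_count V E k u v = (near_count V E u v - 1) choose (k - 1)"
proof -
  obtain A where cut: "bridge_cut V E u v A" using tree_edge_bridge_cut assms by metis
  have conn: "connected_graph V E" using tree by (simp add: tree_graph_def)
  have "u \<in> A" "A \<subseteq> V" using cut by (auto simp: bridge_cut_def)
  moreover from this conn have "finite A"
    using finite_subset unfolding connected_graph_def simple_graph_def by metis
  \<comment> \<open>Since \<open>u \<in> A\<close>, the set \<open>A - {u}\<close> has exactly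
    \<open>card A - 1\<close> elements.\<close>
  ultimately have "steiner_near_count V E k u v = (card A - 1) choose (k - 1)"
    by (simp add: steiner_near_count_def bridge_cut_steiner_near_sets[OF cut conn \<open>2 \<le> k\<close>] n_subsets)
  then show ?thesis by (simp add: near_count_def bridge_cut_near_set[OF cut conn])
qed

theorem theorem2p1:
  fixes V :: "'a set" and E :: "'a set set" and n k :: nat
  assumes "tree_graph V E"
    and "n = card V"
    and "2 \<le> k" and "k \<le> n - 1"
  shows "steiner_szeged V E k =
    edge_sum E (\<lambda>u v. ((near_count V E u v - 1 choose (k - 1)) + 1) *
                      ((near_count V E v u - 1 choose (k - 1)) + 1))"
  unfolding steiner_szeged_def edge_sum_def
proof (rule sum.cong[OF refl])
  fix e assume "e \<in> E"
  moreover from this obtain u v where e: "e = {u, v}"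
    using assms(1) unfolding tree_graph_def connected_graph_def simple_graph_def by metis
  ultimately have uv: "{u, v} \<in> E" "{v, u} \<in> E" by (auto simp: insert_commute)
  let ?f = "\<lambda>u v. (steiner_near_count V E k u v + 1) * (steiner_near_count V E k v u + 1)"
  let ?g = "\<lambda>u v. ((near_count V E u v - 1 choose (k - 1)) + 1) *
                 ((near_count V E v u - 1 choose (k - 1)) + 1)"
  \<comment> \<open>Exchanging \<open>u\<close> and \<open>v\<close> only swaps the factors, so the
    value of the edge is well defined.\<close>
  have "edge_val ?f {u, v} = ?f u v" by (rule edge_val_eq) (rule mult.commute)
  also have "\<dots> = ?g u v"
    by (simp only: tree_steiner_near_count[OF assms(1) uv(1) assms(3)]
        tree_steiner_near_count[OF assms(1) uv(2) assms(3)])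
  also have "\<dots> = edge_val ?g {u, v}"
    by (rule edge_val_eq[symmetric]) (rule mult.commute)
  finally show "edge_val ?f e = edge_val ?g e" unfolding e .
qed

end
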